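(* Let $\mathcal{R}$ be a weakly spare probabilistic term rewrite system (PTRS), and let $\mathcal{DP}(\mathcal{R})$ be its set of canonical annotated dependency pairs. Then $\mathcal{R}$ is $\mathtt{bAST}$ (almost-surely terminating for basic start terms) if and only if the basic ADP problem $(\emptyset,\mathcal{DP}(\mathcal{R}))$ is $\mathtt{bAST}$.
   Context: **Terms.** $\Sigma$ is a finite signature, $\mathcal{V}$ a set of variables, $\mathcal{T}=\mathcal{T}(\Sigma,\mathcal{V})$ the set of terms. $\mathcal{V}(t)$ is the set of variables of $t$; $\mathrm{Pos}(t)$ the set of positions of $t$ (root position $\varepsilon$); $t|_\pi$ the subterm at $\pi$; $t[r]_\pi$ the replacement of that subterm by $r$. A substitution is $\sigma:\mathcal{V}\to\mathcal{T}$ with $\sigma(x)=x$ for all but finitely many $x$. **PTRSs.** A finite multi-distribution on a set $M$ is a finite multiset of pairs $(p:a)$ with $0<p\le 1$, $a\in M$, whose probabilities sum to $1$; $\mathrm{Supp}(\mu)$ is the multiset of the $a$'s occurring in $\mu$. A probabilistic rule $\ell\to\mu$ consists of a term $\ell\in\mathcal{T}\setminus\mathcal{V}$ and a finite multi-distribution $\mu$ on $\mathcal{T}$ with $\mathcal{V}(r)\subseteq\mathcal{V}(\ell)$ for all $r\in\mathrm{Supp}(\mu)$. A PTRS $\mathcal{R}$ is a finite set of such rules. We have $s\to_{\mathcal{R}}\{p_1:t_1,\dots,p_k:t_k\}$ if there are $\ell\to\{p_1:r_1,\dots,p_k:r_k\}\in\mathcal{R}$, a substitution $\sigma$ and $\pi\in\mathrm{Pos}(s)$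 with $s|_\pi=\ell\sigma$ and $t_j=s[r_j\sigma]_\pi$ for all $j$. $\mathtt{NF}_{\mathcal{R}}$ is the set of terms that cannot be rewritten with $\to_{\mathcal{R}}$. $\mathcal{D}\subseteq\Sigma$ is the set of defined symbols, i.e., root symbols of left-hand sides of rules of $\mathcal{R}$; $\mathcal{C}=\Sigma\setminus\mathcal{D}$ is the set of constructors. A term is basic if it has the form $f(t_1,\dots,t_n)$ with $f\in\mathcal{D}$ and $t_i\in\mathcal{T}(\mathcal{C},\mathcal{V})$ for all $i$. **bAST of a PTRS.** An $\mathcal{R}$-rewrite sequence tree (RST) is a (possibly infinite) finitely branching tree whose nodes $v$ are labeled by pairs $(p_v:t_v)$ of a probability and a term, the root having probability $1$, such that for each node $v$ with successors $w_1,\dots,w_k$ ($k\ge1$), $t_v\to_{\mathcal{R}}\{\frac{p_{w_1}}{p_v}:t_{w_1},\dots,\frac{p_{w_k}}{p_v}:t_{w_k}\}$. $|\mathfrak{T}|_{\mathrm{Leaf}}$ is the sum of $p_v$ over all leaves $v$ of $\mathfrak{T}$. $\mathcal{R}$ is $\mathtt{bAST}$ if $|\mathfrak{T}|_{\mathrm{Leaf}}=1$ for all $\mathcal{R}$-RSTs $\mathfrak{T}$ whose root is labeled by $(1:t)$ for a basic term $t$. **Weak spareness.** A rewrite step with rule $\ell\to\mu$ and substitution $\sigma$ (applied to the redex $\ell\sigma$) is weakly spare if $\sigma(x)\in\mathtt{NF}_{\mathcal{R}}$ for every variable $x$ that occurs less often in $\ell$ than in some $r\in\mathrm{Supp}(\mu)$.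 An $\mathcal{R}$-RST is weakly spare if all rewrite steps corresponding to its edges are weakly spare. $\mathcal{R}$ is weakly spare if every $\mathcal{R}$-RST whose root is labeled $(1:t)$ for a basic term $t$ is weakly spare. **Annotations.** For each $f\in\mathcal{D}$ let $f^\#$ be a fresh symbol of the same arity; $\mathcal{D}^\#=\{f^\#\mid f\in\mathcal{D}\}$, $\Sigma^\#=\Sigma\uplus\mathcal{D}^\#$, $\mathcal{T}^\#=\mathcal{T}(\Sigma^\#,\mathcal{V})$. For $t=f(t_1,\dots,t_n)\in\mathcal{T}$ with $f\in\mathcal{D}$, $t^\#=f^\#(t_1,\dots,t_n)$. $\mathrm{Pos}_X(t)$ is the set of positions of $t$ carrying a symbol or variable from $X$. For $\Phi\subseteq\mathrm{Pos}_{\mathcal{D}\cup\mathcal{D}^\#}(t)$, $\#_\Phi(t)$ is the variant of $t$ where exactly the symbols at positions in $\Phi$ are annotated (all other annotations are removed); $\flat(t)=\#_\emptyset(t)$. $\flat^\uparrow_\pi(t)$ results from $t$ by removing all annotations strictly above position $\pi$. **ADPs.** An annotated dependency pair (ADP) has the form $\ell\to\{p_1:r_1,\dots,p_k:r_k\}^m$ with $\ell\in\mathcal{T}\setminus\mathcal{V}$, $m\in\{\mathsf{true},\mathsf{false}\}$, $r_j\in\mathcal{T}^\#$, $\mathcal{V}(r_j)\subseteq\mathcal{V}(\ell)$, probabilities $p_j\in(0,1]$ summing to $1$. The canonical ADP of a rule $\ell\to\{p_1:r_1,\dots,p_k:r_k\}$ is $\ell\to\{p_1:\#_{\mathrm{Pos}_{\mathcal{D}}(r_1)}(r_1),\dots,p_k:\#_{\mathrm{Pos}_{\mathcal{D}}(r_k)}(r_k)\}^{\mathsf{true}}$;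 $\mathcal{DP}(\mathcal{R})$ is the set of canonical ADPs of all rules of $\mathcal{R}$. **Rewriting with ADPs.** A variable reposition function (VRF) for an ADP $\ell\to\{p_1:r_1,\dots,p_k:r_k\}^m$ is a family of functions $\varphi_j:\mathrm{Pos}_{\mathcal{V}}(\ell)\to\mathrm{Pos}_{\mathcal{V}}(r_j)\uplus\{\bot\}$, $1\le j\le k$, with $\ell|_\rho=r_j|_{\varphi_j(\rho)}$ whenever $\varphi_j(\rho)\ne\bot$. For a finite set $\mathcal{P}$ of ADPs, a term $s\in\mathcal{T}^\#$ rewrites with $\mathcal{P}$ to $\{p_1:t_1,\dots,p_k:t_k\}$ (written $s\hookrightarrow_{\mathcal{P}}\{p_1:t_1,\dots,p_k:t_k\}$) if there are an ADP $\ell\to\{p_1:r_1,\dots,p_k:r_k\}^m\in\mathcal{P}$, a VRF $(\varphi_j)_j$ for it, a substitution $\sigma$ and $\pi\in\mathrm{Pos}_{\mathcal{D}\cup\mathcal{D}^\#}(s)$ with $\flat(s|_\pi)=\ell\sigma$, such that for all $j$: - (at) $t_j=s[\#_{\Phi_j}(r_j\sigma)]_\pi$ if $\pi\in\mathrm{Pos}_{\mathcal{D}^\#}(s)$ and $m=\mathsf{true}$; - (af) $t_j=\flat^\uparrow_\pi(s[\#_{\Phi_j}(r_j\sigma)]_\pi)$ if $\pi\in\mathrm{Pos}_{\mathcal{D}^\#}(s)$ and $m=\mathsf{false}$; - (nt) $t_j=s[\#_{\Psi_j}(r_j\sigma)]_\pi$ if $\pi\notin\mathrm{Pos}_{\mathcal{D}^\#}(s)$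 and $m=\mathsf{true}$. (There is no step if $\pi\notin\mathrm{Pos}_{\mathcal{D}^\#}(s)$ and $m=\mathsf{false}$.) Here $\Psi_j=\{\varphi_j(\rho).\tau\mid\rho\in\mathrm{Pos}_{\mathcal{V}}(\ell),\ \varphi_j(\rho)\ne\bot,\ \rho.\tau\in\mathrm{Pos}_{\mathcal{D}^\#}(s|_\pi)\}$ and $\Phi_j=\mathrm{Pos}_{\mathcal{D}^\#}(r_j)\cup\Psi_j$. **Chain trees and bAST of a basic ADP problem.** A $\mathcal{P}$-chain tree (CT) is $\mathfrak{T}=(V,E,L,A)$ where $(V,E)$ is a non-empty, possibly infinite, finitely branching directed tree; $L$ labels each node $v$ by a probability $p_v\in(0,1]$ and a term $t_v\in\mathcal{T}^\#$, with $p_v=1$ for the root; $A$ is a subset of the inner nodes; for each inner node $v$ with successors $w_1,\dots,w_k$, $t_v\hookrightarrow_{\mathcal{P}}\{\frac{p_{w_1}}{p_v}:t_{w_1},\dots,\frac{p_{w_k}}{p_v}:t_{w_k}\}$ using case (at) or (af) if $v\in A$ and another case if $v\notin A$; and every infinite path contains infinitely many nodes from $A$. $|\mathfrak{T}|_{\mathrm{Leaf}}$ is the sum of $p_v$ over all leaves $v$. A basic ADP problem is a pair $(\mathcal{I},\mathcal{P})$ of finite sets of ADPs; it is $\mathtt{bAST}$ if $|\mathfrak{T}|_{\mathrm{Leaf}}=1$ for all those $(\mathcal{I}\cup\mathcal{P})$-CTs $\mathfrak{T}$ whose root term is $t^\#$ for a basic term $t\in\mathcal{T}$ and in which ADPs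 from $\mathcal{I}\setminus\mathcal{P}$ are used only finitely often within the whole tree. *)

theory Defs
  imports
    "HOL-Library.Multiset"
    "HOL-Library.Sublist"
    "HOL-Analysis.Infinite_Sum"
begin

section \<open>Terms\<close>

datatype (funs_term: 'f, vars_term: 'v) "term" =
    Var 'v
  | Fun 'f "('f, 'v) term list"

text \<open>
  A signature is a partial map from symbols to arities: its domain is the set of symbols.
  The whole type \<open>'v\<close> serves as the set of variables, and \<open>wf_term \<Sigma>\<close> singles out
  the set of terms over the signature \<open>\<Sigma>\<close>.
\<close>

type_synonym 'f sig = "'f \<rightharpoonup> nat"

fun wf_term :: "'f sig \<Rightarrow> ('f, 'v) term \<Rightarrow> bool" where
  "wf_term \<Sigma> (Var x) \<longleftrightarrow> True"
| "wf_term \<Sigma> (Fun f ts) \<longleftrightarrow> \<Sigma> f = Some (length ts) \<and> (\<forall>t\<in>set ts. wf_term \<Sigma> t)"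

lemma size_nth_less [termination_simp]:
  "i < length ts \<Longrightarrow> size (ts ! i) < Suc (size_list size ts)"
  by (metis less_Suc_eq_le nth_mem order_refl size_list_estimation')

type_synonym pos = "nat list"

text \<open>Argument positions are counted from 0.\<close>

fun poss :: "('f, 'v) term \<Rightarrow> pos set" where
  "poss (Var x) = {[]}"
| "poss (Fun f ts) = {[]} \<union> (\<Union>i<length ts. (#) i ` poss (ts ! i))"

fun subt_at :: "('f, 'v) term \<Rightarrow> pos \<Rightarrow> ('f, 'v) term" (infixl "|'_" 67) where
  "t |_ [] = t"
| "Fun f ts |_ (i # \<pi>) = (ts ! i) |_ \<pi>"
| "Var x |_ (i # \<pi>) = undefined"

fun replace_at :: "('f, 'v) term \<Rightarrow> pos \<Rightarrow> ('f, 'v) term \<Rightarrow> ('f, 'v) term" where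
  "replace_at t [] u = u"
| "replace_at (Fun f ts) (i # \<pi>) u = Fun f (ts[i := replace_at (ts ! i) \<pi> u])"
| "replace_at (Var x) (i # \<pi>) u = undefined"

definition var_poss :: "('f, 'v) term \<Rightarrow> pos set" where
  "var_poss t = {\<pi> \<in> poss t. \<exists>x. t |_ \<pi> = Var x}"

definition sym_poss :: "'f set \<Rightarrow> ('f, 'v) term \<Rightarrow> pos set" where
  "sym_poss X t = {\<pi> \<in> poss t. \<exists>f ts. t |_ \<pi> = Fun f ts \<and> f \<in> X}"

definition occs :: "'v \<Rightarrow> ('f, 'v) term \<Rightarrow> nat" where
  "occs x t = card {\<pi> \<in> poss t. t |_ \<pi> = Var x}"

fun subst_apply :: "('f, 'v) term \<Rightarrow> ('v \<Rightarrow> ('f, 'v) term) \<Rightarrow> ('f, 'v) term" (infixl "\<cdot>" 67) where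
  "Var x \<cdot> \<sigma> = \<sigma> x"
| "Fun f ts \<cdot> \<sigma> = Fun f (map (\<lambda>t. t \<cdot> \<sigma>) ts)"

definition is_subst :: "'f sig \<Rightarrow> ('v \<Rightarrow> ('f, 'v) term) \<Rightarrow> bool" where
  "is_subst \<Sigma> \<sigma> \<longleftrightarrow> finite {x. \<sigma> x \<noteq> Var x} \<and> (\<forall>x. wf_term \<Sigma> (\<sigma> x))"


section \<open>Probabilistic term rewrite systems\<close>

type_synonym 'a mdist = "(real \<times> 'a) multiset"

definition is_mdist :: "'a mdist \<Rightarrow> bool" where
  "is_mdist \<mu> \<longleftrightarrow> (\<forall>(p, a) \<in># \<mu>. 0 < p \<and> p \<le> 1) \<and> (\<Sum>(p, a) \<in># \<mu>. p) = 1"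

definition Supp :: "'a mdist \<Rightarrow> 'a multiset" where
  "Supp \<mu> = image_mset snd \<mu>"

type_synonym ('f, 'v) prule = "('f, 'v) term \<times> ('f, 'v) term mdist"
type_synonym ('f, 'v) ptrs = "('f, 'v) prule set"

definition is_prule :: "'f sig \<Rightarrow> ('f, 'v) prule \<Rightarrow> bool" where
  "is_prule \<Sigma> = (\<lambda>(l, \<mu>). wf_term \<Sigma> l \<and> (\<forall>x. l \<noteq> Var x) \<and> is_mdist \<mu> \<and>
     (\<forall>r \<in># Supp \<mu>. wf_term \<Sigma> r \<and> vars_term r \<subseteq> vars_term l))"

definition is_ptrs :: "'f sig \<Rightarrow> ('f, 'v) ptrs \<Rightarrow> bool" where
  "is_ptrs \<Sigma> R \<longleftrightarrow> finite R \<and> (\<forall>\<rho>\<in>R. is_prule \<Sigma> \<rho>)"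

definition prewrite_with ::
  "'f sig \<Rightarrow> ('f, 'v) prule \<Rightarrow> ('v \<Rightarrow> ('f, 'v) term) \<Rightarrow> pos \<Rightarrow>
   ('f, 'v) term \<Rightarrow> ('f, 'v) term mdist \<Rightarrow> bool" where
  "prewrite_with \<Sigma> = (\<lambda>(l, \<mu>) \<sigma> \<pi> s M.
     is_subst \<Sigma> \<sigma> \<and> \<pi> \<in> poss s \<and> s |_ \<pi> = l \<cdot> \<sigma> \<and>
     M = image_mset (\<lambda>(p, r). (p, replace_at s \<pi> (r \<cdot> \<sigma>))) \<mu>)"

definition prewrite ::
  "'f sig \<Rightarrow> ('f, 'v) ptrs \<Rightarrow> ('f, 'v) term \<Rightarrow> ('f, 'v) term mdist \<Rightarrow> bool" where
  "prewrite \<Sigma> R s M \<longleftrightarrow> (\<exists>\<rho>\<in>R. \<exists>\<sigma> \<pi>. prewrite_with \<Sigma> \<rho> \<sigma> \<pi> s M)"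

definition NF :: "'f sig \<Rightarrow> ('f, 'v) ptrs \<Rightarrow> ('f, 'v) term set" where
  "NF \<Sigma> R = {s. wf_term \<Sigma> s \<and> (\<nexists>M. prewrite \<Sigma> R s M)}"

definition defined_syms :: "('f, 'v) ptrs \<Rightarrow> 'f set" where
  "defined_syms R = {f. \<exists>ts \<mu>. (Fun f ts, \<mu>) \<in> R}"

definition is_basic :: "'f sig \<Rightarrow> 'f set \<Rightarrow> ('f, 'v) term \<Rightarrow> bool" where
  "is_basic \<Sigma> D t \<longleftrightarrow> wf_term \<Sigma> t \<and>
     (\<exists>f ts. t = Fun f ts \<and> f \<in> D \<and> (\<forall>u\<in>set ts. wf_term (\<Sigma> |` (- D)) u))"


section \<open>Labeled trees\<close>

record ('n, 't) ltree =
  nodes :: "'n set"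
  edges :: "'n rel"
  prob :: "'n \<Rightarrow> real"
  lab :: "'n \<Rightarrow> 't"

definition directed_tree :: "'n set \<Rightarrow> 'n rel \<Rightarrow> 'n \<Rightarrow> bool" where
  "directed_tree V E r \<longleftrightarrow>
     E \<subseteq> V \<times> V \<and> r \<in> V \<and> (\<forall>u. (u, r) \<notin> E) \<and>
     (\<forall>u u' v. (u, v) \<in> E \<longrightarrow> (u', v) \<in> E \<longrightarrow> u = u') \<and>
     (\<forall>v\<in>V. (r, v) \<in> E\<^sup>*)"

definition is_ltree :: "('n, 't) ltree \<Rightarrow> 'n \<Rightarrow> bool" where
  "is_ltree T r \<longleftrightarrow> directed_tree (nodes T) (edges T) r \<and>
     (\<forall>v. finite (edges T `` {v})) \<and>
     (\<forall>v\<in>nodes T. 0 < prob T v \<and> prob T v \<le> 1) \<and> prob T r = 1"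

definition inner_nodes :: "('n, 't) ltree \<Rightarrow> 'n set" where
  "inner_nodes T = {v \<in> nodes T. edges T `` {v} \<noteq> {}}"

definition leaves :: "('n, 't) ltree \<Rightarrow> 'n set" where
  "leaves T = {v \<in> nodes T. edges T `` {v} = {}}"

definition leaf_mass :: "('n, 't) ltree \<Rightarrow> real" where
  "leaf_mass T = (\<Sum>\<^sub>\<infinity>v\<in>leaves T. prob T v)"

definition succ_mdist :: "('n, 't) ltree \<Rightarrow> 'n \<Rightarrow> 't mdist" where
  "succ_mdist T v = image_mset (\<lambda>w. (prob T w / prob T v, lab T w)) (mset_set (edges T `` {v}))"


section \<open>Almost-sure termination on basic terms and weak spareness\<close>

definition is_rst ::
  "'f sig \<Rightarrow> ('f, 'v) ptrs \<Rightarrow> ('n, ('f, 'v) term) ltree \<Rightarrow> 'n \<Rightarrow> bool" where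
  "is_rst \<Sigma> R T r \<longleftrightarrow> is_ltree T r \<and> (\<forall>v\<in>nodes T. wf_term \<Sigma> (lab T v)) \<and>
     (\<forall>v\<in>inner_nodes T. prewrite \<Sigma> R (lab T v) (succ_mdist T v))"

text \<open>
  Finitely branching trees are countable, so quantifying over trees with nodes in
  \<^typ>\<open>nat\<close> covers all of them up to isomorphism.
\<close>

definition bAST :: "'f sig \<Rightarrow> ('f, 'v) ptrs \<Rightarrow> bool" where
  "bAST \<Sigma> R \<longleftrightarrow> (\<forall>(T :: (nat, ('f, 'v) term) ltree) r.
     is_rst \<Sigma> R T r \<and> is_basic \<Sigma> (defined_syms R) (lab T r) \<longrightarrow> leaf_mass T = 1)"

definition weakly_spare_step ::
  "'f sig \<Rightarrow> ('f, 'v) ptrs \<Rightarrow> ('f, 'v) prule \<Rightarrow> ('v \<Rightarrow> ('f, 'v) term) \<Rightarrow> bool" where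
  "weakly_spare_step \<Sigma> R = (\<lambda>(l, \<mu>) \<sigma>.
     \<forall>x. (\<exists>r \<in># Supp \<mu>. occs x l < occs x r) \<longrightarrow> \<sigma> x \<in> NF \<Sigma> R)"

text \<open>
  A node label does not record the rule, substitution and position of the step, so all
  choices that give rise to the edges below a node are taken into account.
\<close>

definition weakly_spare_rst ::
  "'f sig \<Rightarrow> ('f, 'v) ptrs \<Rightarrow> ('n, ('f, 'v) term) ltree \<Rightarrow> bool" where
  "weakly_spare_rst \<Sigma> R T \<longleftrightarrow> (\<forall>v\<in>inner_nodes T. \<forall>\<rho>\<in>R. \<forall>\<sigma> \<pi>.
     prewrite_with \<Sigma> \<rho> \<sigma> \<pi> (lab T v) (succ_mdist T v) \<longrightarrow> weakly_spare_step \<Sigma> R \<rho> \<sigma>)"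

definition weakly_spare :: "'f sig \<Rightarrow> ('f, 'v) ptrs \<Rightarrow> bool" where
  "weakly_spare \<Sigma> R \<longleftrightarrow> (\<forall>(T :: (nat, ('f, 'v) term) ltree) r.
     is_rst \<Sigma> R T r \<and> is_basic \<Sigma> (defined_syms R) (lab T r) \<longrightarrow> weakly_spare_rst \<Sigma> R T)"


section \<open>Annotated terms\<close>

text \<open>
  Unannotated terms have type \<open>('f, 'v) term\<close> and annotated ones \<open>('f asym, 'v) term\<close>, where
  \<open>Sharp f\<close> is the fresh copy of \<open>f\<close>. The function \<open>plain\<close> embeds the former into the latter.
\<close>

datatype 'f asym = Plain (base: 'f) | Sharp (base: 'f)

definition sharp_sig :: "'f sig \<Rightarrow> 'f set \<Rightarrow> 'f asym sig" where
  "sharp_sig \<Sigma> D = case_asym \<Sigma> (\<Sigma> |` D)"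

definition plain :: "('f, 'v) term \<Rightarrow> ('f asym, 'v) term" where
  "plain = map_term Plain id"

definition flat :: "('f asym, 'v) term \<Rightarrow> ('f, 'v) term" where
  "flat = map_term base id"

fun annotate :: "pos set \<Rightarrow> ('f asym, 'v) term \<Rightarrow> ('f asym, 'v) term" where
  "annotate \<Phi> (Var x) = Var x"
| "annotate \<Phi> (Fun f ts) =
     Fun (if [] \<in> \<Phi> then Sharp (base f) else Plain (base f))
       (map (\<lambda>i. annotate {\<pi>. i # \<pi> \<in> \<Phi>} (ts ! i)) [0..<length ts])"

fun sharp_root :: "('f, 'v) term \<Rightarrow> ('f asym, 'v) term" where
  "sharp_root (Fun f ts) = Fun (Sharp f) (map plain ts)"
| "sharp_root (Var x) = Var x"

definition flat_above :: "'f set \<Rightarrow> pos \<Rightarrow> ('f asym, 'v) term \<Rightarrow> ('f asym, 'v) term" where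
  "flat_above D \<pi> t = annotate {\<tau> \<in> sym_poss (Sharp ` D) t. \<not> strict_prefix \<tau> \<pi>} t"

lemma flat_plain: "flat (plain t) = t"
  by (induction t) (auto simp: flat_def plain_def map_idI)

lemma plain_flat: "plain (flat t) = annotate {} t"
  by (induction t) (auto simp: flat_def plain_def intro!: nth_equalityI)


section \<open>Annotated dependency pairs\<close>

type_synonym ('f, 'v) adp = "('f, 'v) term \<times> ('f asym, 'v) term mdist \<times> bool"

definition is_adp :: "'f sig \<Rightarrow> 'f set \<Rightarrow> ('f, 'v) adp \<Rightarrow> bool" where
  "is_adp \<Sigma> D = (\<lambda>(l, \<mu>, m). wf_term \<Sigma> l \<and> (\<forall>x. l \<noteq> Var x) \<and> is_mdist \<mu> \<and>
     (\<forall>r \<in># Supp \<mu>. wf_term (sharp_sig \<Sigma> D) r \<and> vars_term r \<subseteq> vars_term l))"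

definition canonical_adp :: "'f set \<Rightarrow> ('f, 'v) prule \<Rightarrow> ('f, 'v) adp" where
  "canonical_adp D = (\<lambda>(l, \<mu>).
     (l, image_mset (\<lambda>(p, r). (p, annotate (sym_poss D r) (plain r))) \<mu>, True))"

definition DP :: "('f, 'v) ptrs \<Rightarrow> ('f, 'v) adp set" where
  "DP R = canonical_adp (defined_syms R) ` R"

definition is_vrf ::
  "('f, 'v) term \<Rightarrow> ('f asym, 'v) term \<Rightarrow> (pos \<Rightarrow> pos option) \<Rightarrow> bool" where
  "is_vrf l r \<phi> \<longleftrightarrow> (\<forall>\<rho>\<in>var_poss l. \<forall>\<pi>. \<phi> \<rho> = Some \<pi> \<longrightarrow>
     \<pi> \<in> var_poss r \<and> plain (l |_ \<rho>) = r |_ \<pi>)"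

text \<open>
  In \<open>Psi_set D l \<phi> u\<close> and \<open>Phi_set D l r \<phi> u\<close> the argument \<open>u\<close> is the annotated redex.
\<close>

definition Psi_set ::
  "'f set \<Rightarrow> ('f, 'v) term \<Rightarrow> (pos \<Rightarrow> pos option) \<Rightarrow> ('f asym, 'v) term \<Rightarrow> pos set" where
  "Psi_set D l \<phi> u = {\<pi> @ \<tau> |\<pi> \<tau> \<rho>.
     \<rho> \<in> var_poss l \<and> \<phi> \<rho> = Some \<pi> \<and> \<rho> @ \<tau> \<in> sym_poss (Sharp ` D) u}"

definition Phi_set ::
  "'f set \<Rightarrow> ('f, 'v) term \<Rightarrow> ('f asym, 'v) term \<Rightarrow> (pos \<Rightarrow> pos option) \<Rightarrow>
   ('f asym, 'v) term \<Rightarrow> pos set" where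
  "Phi_set D l r \<phi> u = sym_poss (Sharp ` D) r \<union> Psi_set D l \<phi> u"

datatype step_case = AT | AF | NT

fun case_applies :: "'f set \<Rightarrow> step_case \<Rightarrow> ('f asym, 'v) term \<Rightarrow> pos \<Rightarrow> bool \<Rightarrow> bool" where
  "case_applies D AT s \<pi> m \<longleftrightarrow> \<pi> \<in> sym_poss (Sharp ` D) s \<and> m"
| "case_applies D AF s \<pi> m \<longleftrightarrow> \<pi> \<in> sym_poss (Sharp ` D) s \<and> \<not> m"
| "case_applies D NT s \<pi> m \<longleftrightarrow> \<pi> \<notin> sym_poss (Sharp ` D) s \<and> m"

fun adp_result ::
  "'f set \<Rightarrow> step_case \<Rightarrow> ('f asym, 'v) term \<Rightarrow> pos \<Rightarrow> ('f, 'v) term \<Rightarrow> ('v \<Rightarrow> ('f, 'v) term) \<Rightarrow>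
   (pos \<Rightarrow> pos option) \<Rightarrow> ('f asym, 'v) term \<Rightarrow> ('f asym, 'v) term" where
  "adp_result D AT s \<pi> l \<sigma> \<phi> r =
     replace_at s \<pi> (annotate (Phi_set D l r \<phi> (s |_ \<pi>)) (r \<cdot> (plain \<circ> \<sigma>)))"
| "adp_result D AF s \<pi> l \<sigma> \<phi> r =
     flat_above D \<pi>
       (replace_at s \<pi> (annotate (Phi_set D l r \<phi> (s |_ \<pi>)) (r \<cdot> (plain \<circ> \<sigma>))))"
| "adp_result D NT s \<pi> l \<sigma> \<phi> r =
     replace_at s \<pi> (annotate (Psi_set D l \<phi> (s |_ \<pi>)) (r \<cdot> (plain \<circ> \<sigma>)))"

text \<open>
  The list \<open>rs\<close> enumerates the right-hand sides: equal entries of \<open>\<mu>\<close> may use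
  different reposition functions.
\<close>

definition adp_step ::
  "'f sig \<Rightarrow> 'f set \<Rightarrow> ('f, 'v) adp \<Rightarrow> step_case \<Rightarrow>
   ('f asym, 'v) term \<Rightarrow> ('f asym, 'v) term mdist \<Rightarrow> bool" where
  "adp_step \<Sigma> D = (\<lambda>(l, \<mu>, m) c s M. \<exists>rs \<phi> \<sigma> \<pi>.
     mset rs = \<mu> \<and> (\<forall>j<length rs. is_vrf l (snd (rs ! j)) (\<phi> j)) \<and>
     is_subst \<Sigma> \<sigma> \<and> \<pi> \<in> sym_poss (Plain ` D \<union> Sharp ` D) s \<and> flat (s |_ \<pi>) = l \<cdot> \<sigma> \<and>
     case_applies D c s \<pi> m \<and>
     M = mset (map (\<lambda>j. (fst (rs ! j), adp_result D c s \<pi> l \<sigma> (\<phi> j) (snd (rs ! j))))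
           [0..<length rs]))"

text \<open>
  In \<open>is_chain_tree \<Sigma> D P T r A \<alpha>\<close> the function \<open>\<alpha>\<close> records which ADP is used at each
  inner node.
\<close>

definition is_chain_tree ::
  "'f sig \<Rightarrow> 'f set \<Rightarrow> ('f, 'v) adp set \<Rightarrow> ('n, ('f asym, 'v) term) ltree \<Rightarrow> 'n \<Rightarrow>
   'n set \<Rightarrow> ('n \<Rightarrow> ('f, 'v) adp) \<Rightarrow> bool" where
  "is_chain_tree \<Sigma> D P T r A \<alpha> \<longleftrightarrow>
     is_ltree T r \<and> (\<forall>v\<in>nodes T. wf_term (sharp_sig \<Sigma> D) (lab T v)) \<and>
     A \<subseteq> inner_nodes T \<and>
     (\<forall>v\<in>inner_nodes T. \<alpha> v \<in> P \<and>
        (\<exists>c. (v \<in> A \<longleftrightarrow> c \<in> {AT, AF}) \<and> adp_step \<Sigma> D (\<alpha> v) c (lab T v) (succ_mdist T v))) \<and>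
     (\<forall>f :: nat \<Rightarrow> 'n. (\<forall>i. (f i, f (Suc i)) \<in> edges T) \<longrightarrow> infinite (range f \<inter> A))"

definition adp_bAST ::
  "'f sig \<Rightarrow> 'f set \<Rightarrow> ('f, 'v) adp set \<times> ('f, 'v) adp set \<Rightarrow> bool" where
  "adp_bAST \<Sigma> D = (\<lambda>(I, P).
     \<forall>(T :: (nat, ('f asym, 'v) term) ltree) r A \<alpha>.
       is_chain_tree \<Sigma> D (I \<union> P) T r A \<alpha> \<and>
       (\<exists>t. is_basic \<Sigma> D t \<and> lab T r = sharp_root t) \<and>
       finite {v \<in> inner_nodes T. \<alpha> v \<in> I - P} \<longrightarrow>
       leaf_mass T = 1)"

lemma wf_annotate_plain:
  assumes "wf_term \<Sigma> t" and "\<Phi> \<subseteq> sym_poss D t"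
  shows "wf_term (sharp_sig \<Sigma> D) (annotate \<Phi> (plain t))"
  using assms
proof (induction t arbitrary: \<Phi>)
  case (Var x)
  then show ?case by (simp add: plain_def)
next
  case (Fun f ts)
  have "wf_term (sharp_sig \<Sigma> D) (annotate {\<pi>. i # \<pi> \<in> \<Phi>} (plain (ts ! i)))" if "i < length ts" for i
    using Fun.prems that by (intro Fun.IH) (auto simp: sym_poss_def)
  then show ?case
    using Fun.prems by (auto simp: plain_def sharp_sig_def sym_poss_def)
qed

lemma vars_annotate_plain: "vars_term (annotate \<Phi> (plain t)) = vars_term t"
proof (induction t arbitrary: \<Phi>)
  case (Var x)
  then show ?case by (simp add: plain_def)
next
  case (Fun f ts)
  have "vars_term (annotate \<Psi> (plain (ts ! i))) = vars_term (ts ! i)" if "i < length ts" for i \<Psi>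
    using that by (intro Fun.IH) auto
  then show ?case by (auto simp: plain_def set_conv_nth)
qed

lemma DP_is_adp_set:
  assumes "is_ptrs \<Sigma> R"
  shows "finite (DP R) \<and> (\<forall>d \<in> DP R. is_adp \<Sigma> (defined_syms R) d)"
  using assms
  by (fastforce simp: is_ptrs_def DP_def canonical_adp_def is_adp_def is_prule_def is_mdist_def
      Supp_def case_prod_unfold image_mset.compositionality comp_def
      vars_annotate_plain intro!: wf_annotate_plain)

end

(*
  Flattening all labels turns a chain tree into a rewrite sequence tree. Conversely, the nodes of a
  weakly spare rewrite sequence tree can be annotated from the root downwards so that every defined
  symbol heading a reducible subterm is annotated: whenever a variable is instantiated by a
  reducible term, weak spareness ensures that it does not occur more often in a right-hand side
  than in the left-hand side, so a variable reposition function can reach all its occurrences.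
  Every step then takes place at an annotated position, so the result is a chain tree on the same
  nodes, with every inner node in A. In both directions the leaf mass is unchanged.
*)

theory Submission
  imports Defs
begin

section \<open>Positions\<close>

lemma Nil_in_poss [simp]: "[] \<in> poss t"
  by (cases t) auto

lemma finite_poss: "finite (poss t)"
  by (induction t) auto

lemma poss_append: "\<pi> \<in> poss t \<Longrightarrow> \<pi> @ \<tau> \<in> poss t \<longleftrightarrow> \<tau> \<in> poss (t |_ \<pi>)"
  by (induction t \<pi> rule: subt_at.induct) auto

lemma subt_at_append: "\<pi> \<in> poss t \<Longrightarrow> t |_ (\<pi> @ \<tau>) = t |_ \<pi> |_ \<tau>"
  by (induction t \<pi> rule: subt_at.induct) auto

lemma poss_subst: "\<pi> \<in> poss t \<Longrightarrow> \<pi> \<in> poss (t \<cdot> \<sigma>)"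
  by (induction t \<pi> rule: subt_at.induct) auto

lemma subt_at_subst: "\<pi> \<in> poss t \<Longrightarrow> (t \<cdot> \<sigma>) |_ \<pi> = t |_ \<pi> \<cdot> \<sigma>"
  by (induction t \<pi> rule: subt_at.induct) auto

text \<open>The two cases match the two sources of annotations in \<open>Phi_set\<close>: symbols of
  a right-hand side, and symbols inside the instance of one of its variables.\<close>

lemma poss_subst_cases:
  assumes "\<pi> \<in> poss (t \<cdot> \<sigma>)"
  obtains (inside) f ts where "\<pi> \<in> poss t" "t |_ \<pi> = Fun f ts"
  | (below) x \<rho> \<tau> where "\<pi> = \<rho> @ \<tau>" "\<rho> \<in> poss t" "t |_ \<rho> = Var x" "\<tau> \<in> poss (\<sigma> x)"
  using assms
proof (induction t arbitrary: \<pi> thesis)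
  case (Var x)
  then show ?case by force
next
  case (Fun f ts)
  show ?case
  proof (cases \<pi>)
    case Nil
    then show ?thesis using Fun.prems(1) by simp
  next
    case (Cons i \<pi>')
    then have i: "i < length ts" and \<pi>': "\<pi>' \<in> poss (ts ! i \<cdot> \<sigma>)"
      using Fun.prems(3) by auto
    show ?thesis
    proof (rule Fun.IH[OF nth_mem[OF i] _ _ \<pi>'])
      fix g us assume "\<pi>' \<in> poss (ts ! i)" "ts ! i |_ \<pi>' = Fun g us"
      then show thesis using Fun.prems(1)[of g us] Cons i by auto
    next
      fix x \<rho> \<tau>
      assume "\<pi>' = \<rho> @ \<tau>" "\<rho> \<in> poss (ts ! i)" "ts ! i |_ \<rho> = Var x" "\<tau> \<in> poss (\<sigma> x)"
      then show thesis using Fun.prems(2)[of "i # \<rho>" \<tau> x] Cons i by auto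
    qed
  qed
qed

lemma wf_term_subt_at: "wf_term \<Sigma> t \<Longrightarrow> \<pi> \<in> poss t \<Longrightarrow> wf_term \<Sigma> (t |_ \<pi>)"
  by (induction t \<pi> rule: subt_at.induct) auto

lemma wf_term_replace_at:
  "wf_term \<Sigma> t \<Longrightarrow> \<pi> \<in> poss t \<Longrightarrow> wf_term \<Sigma> u \<Longrightarrow> wf_term \<Sigma> (replace_at t \<pi> u)"
proof (induction t \<pi> u rule: replace_at.induct)
  case (2 f ts i \<pi> u)
  then have "wf_term \<Sigma> (replace_at (ts ! i) \<pi> u)" by auto
  with 2 show ?case by (auto dest!: set_update_subset_insert[THEN subsetD])
qed auto

lemma wf_term_subst: "wf_term \<Sigma> t \<Longrightarrow> \<forall>x. wf_term \<Sigma> (\<sigma> x) \<Longrightarrow> wf_term \<Sigma> (t \<cdot> \<sigma>)"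
  by (induction t) auto


section \<open>Flattening and annotating\<close>

lemma flat_simps [simp]:
  "flat (Var x) = Var x" "flat (Fun f ts) = Fun (base f) (map flat ts)"
  by (simp_all add: flat_def)

lemma plain_simps [simp]:
  "plain (Var x) = Var x" "plain (Fun f ts) = Fun (Plain f) (map plain ts)"
  by (simp_all add: plain_def)

lemma poss_flat [simp]: "poss (flat t) = poss t"
  by (induction t) auto

lemma flat_subt_at: "\<pi> \<in> poss t \<Longrightarrow> flat t |_ \<pi> = flat (t |_ \<pi>)"
  by (induction t \<pi> rule: subt_at.induct) auto

lemma flat_replace_at:
  "\<pi> \<in> poss t \<Longrightarrow> flat (replace_at t \<pi> u) = replace_at (flat t) \<pi> (flat u)"
  by (induction t \<pi> u rule: replace_at.induct) (auto simp: map_update)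

lemma flat_subst: "flat (t \<cdot> (plain \<circ> \<sigma>)) = flat t \<cdot> \<sigma>"
  by (induction t) (auto simp: flat_plain)

lemma flat_annotate [simp]: "flat (annotate \<Phi> t) = flat t"
proof (induction t arbitrary: \<Phi>)
  case (Fun f ts)
  then show ?case by (auto intro: nth_equalityI)
qed simp

text \<open>\<open>annotate\<close> overwrites every annotation already present, so only the
  underlying term matters.\<close>

lemma annotate_plain_flat: "annotate \<Phi> (plain (flat t)) = annotate \<Phi> t"
  by (induction t arbitrary: \<Phi>) auto

lemma poss_annotate [simp]: "poss (annotate \<Phi> t) = poss t"
  using poss_flat[of "annotate \<Phi> t"] poss_flat[of t] by simp

lemma root_annotate:
  "\<pi> \<in> poss t \<Longrightarrow> t |_ \<pi> = Fun f ts \<Longrightarrow>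
   \<exists>us. annotate \<Phi> t |_ \<pi> = Fun (if \<pi> \<in> \<Phi> then Sharp (base f) else Plain (base f)) us"
proof (induction t \<pi> arbitrary: \<Phi> rule: subt_at.induct)
  case (2 g us i \<pi>)
  then show ?case using "2.IH"[of "{\<pi>. i # \<pi> \<in> \<Phi>}"] by auto
qed auto

lemma wf_term_flat: "wf_term (sharp_sig \<Sigma> D) t \<Longrightarrow> wf_term \<Sigma> (flat t)"
  by (induction t) (auto simp: sharp_sig_def restrict_map_def split: asym.splits if_splits)

lemma sym_poss_flat: "\<pi> \<in> sym_poss (Sharp ` D) t \<Longrightarrow> \<pi> \<in> sym_poss D (flat t)"
  by (fastforce simp: sym_poss_def flat_subt_at)

lemma wf_annotate:
  "wf_term \<Sigma> (flat t) \<Longrightarrow> \<Phi> \<subseteq> sym_poss D (flat t) \<Longrightarrow> wf_term (sharp_sig \<Sigma> D) (annotate \<Phi> t)"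
  using wf_annotate_plain[of \<Sigma> "flat t" \<Phi> D] by (simp add: annotate_plain_flat)

lemma sym_poss_subst: "\<pi> \<in> sym_poss X t \<Longrightarrow> \<pi> \<in> sym_poss X (t \<cdot> \<sigma>)"
  by (auto simp: sym_poss_def poss_subst subt_at_subst)

lemma flat_sharp_root: "flat (sharp_root t) = t"
  by (cases t) (auto simp: flat_plain map_idI)

text \<open>A reposition function sends an occurrence of a variable to an occurrence of the same
  variable. Below both lies the same instance, so a moved annotation again meets a defined
  symbol.\<close>

lemma Psi_set_sym_poss:
  assumes "is_vrf l r \<phi>" "flat u = l \<cdot> \<sigma>"
  shows "Psi_set D l \<phi> u \<subseteq> sym_poss D (flat r \<cdot> \<sigma>)"
proof
  fix \<pi> assume "\<pi> \<in> Psi_set D l \<phi> u"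
  then obtain \<kappa> \<tau> \<rho> where \<pi>: "\<pi> = \<kappa> @ \<tau>" and \<rho>: "\<rho> \<in> var_poss l" and \<phi>: "\<phi> \<rho> = Some \<kappa>"
    and \<tau>: "\<rho> @ \<tau> \<in> sym_poss D (l \<cdot> \<sigma>)"
    using assms(2) sym_poss_flat[of _ D u] by (auto simp: Psi_set_def)
  from \<rho> obtain x where x: "\<rho> \<in> poss l" "l |_ \<rho> = Var x" by (auto simp: var_poss_def)
  have \<kappa>: "\<kappa> \<in> poss r" "r |_ \<kappa> = Var x"
    using assms(1) \<rho> \<phi> x by (fastforce simp: is_vrf_def var_poss_def)+
  have \<kappa>': "\<kappa> \<in> poss (flat r)" "flat r |_ \<kappa> = Var x" using \<kappa> by (auto simp: flat_subt_at)
  show "\<pi> \<in> sym_poss D (flat r \<cdot> \<sigma>)"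
    using \<tau> x \<kappa>'
    by (auto simp: \<pi> sym_poss_def poss_append[OF poss_subst] subt_at_append[OF poss_subst]
        subt_at_subst simp del: poss_flat)
qed


section \<open>Reducibility and the annotation invariant\<close>

definition reducible :: "'f sig \<Rightarrow> ('f, 'v) ptrs \<Rightarrow> ('f, 'v) term \<Rightarrow> bool" where
  "reducible \<Sigma> R s \<longleftrightarrow> (\<exists>M. prewrite \<Sigma> R s M)"

text \<open>Rule, substitution and position determine the resulting multi-distribution, so
  reducibility amounts to the existence of a redex.\<close>

lemma reducible_iff:
  "reducible \<Sigma> R s \<longleftrightarrow> (\<exists>(l, \<mu>)\<in>R. \<exists>\<sigma>. is_subst \<Sigma> \<sigma> \<and> (\<exists>\<pi>\<in>poss s. s |_ \<pi> = l \<cdot> \<sigma>))"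
  unfolding reducible_def prewrite_def prewrite_with_def case_prod_unfold by blast

lemma NF_iff: "s \<in> NF \<Sigma> R \<longleftrightarrow> wf_term \<Sigma> s \<and> \<not> reducible \<Sigma> R s"
  by (simp add: NF_def reducible_def)

lemma reducible_subt_at:
  "\<pi> \<in> poss s \<Longrightarrow> reducible \<Sigma> R (s |_ \<pi>) \<Longrightarrow> reducible \<Sigma> R s"
proof -
  assume \<pi>: "\<pi> \<in> poss s" and "reducible \<Sigma> R (s |_ \<pi>)"
  then obtain l \<mu> \<sigma> \<tau> where "(l, \<mu>) \<in> R" "is_subst \<Sigma> \<sigma>" "\<tau> \<in> poss (s |_ \<pi>)" "s |_ \<pi> |_ \<tau> = l \<cdot> \<sigma>"
    unfolding reducible_iff by blast
  moreover from this have "\<pi> @ \<tau> \<in> poss s" "s |_ (\<pi> @ \<tau>) = l \<cdot> \<sigma>"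
    using \<pi> by (simp_all add: poss_append subt_at_append)
  ultimately show ?thesis unfolding reducible_iff by blast
qed

fun well_annotated :: "'f sig \<Rightarrow> ('f, 'v) ptrs \<Rightarrow> ('f asym, 'v) term \<Rightarrow> bool" where
  "well_annotated \<Sigma> R (Var x) \<longleftrightarrow> True"
| "well_annotated \<Sigma> R (Fun f ts) \<longleftrightarrow>
     (\<forall>g\<in>defined_syms R. f = Plain g \<longrightarrow> \<not> reducible \<Sigma> R (flat (Fun f ts))) \<and>
     (\<forall>t\<in>set ts. well_annotated \<Sigma> R t)"

lemma well_annotated_subt_at:
  "well_annotated \<Sigma> R t \<Longrightarrow> \<pi> \<in> poss t \<Longrightarrow> well_annotated \<Sigma> R (t |_ \<pi>)"
  by (induction t \<pi> rule: subt_at.induct) auto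

text \<open>Serves twice: a redex is reducible and has a defined root, so each lifted step is an
  \<open>AT\<close> step; and reducible subterms inside the substitution carry annotations that can
  be moved.\<close>

lemma well_annotated_sharp:
  assumes "well_annotated \<Sigma> R t" "\<pi> \<in> poss t" "reducible \<Sigma> R (flat t |_ \<pi>)"
    and "flat t |_ \<pi> = Fun f ts" "f \<in> defined_syms R"
  shows "\<pi> \<in> sym_poss (Sharp ` defined_syms R) t"
proof (cases "t |_ \<pi>")
  case (Var x)
  then show ?thesis using assms by (simp add: flat_subt_at)
next
  case (Fun g us)
  with assms well_annotated_subt_at[OF assms(1,2)] have "g = Sharp f"
    by (cases g) (auto simp: flat_subt_at)
  with Fun assms show ?thesis by (auto simp: sym_poss_def)
qed

text \<open>
  The symbols above \<open>\<pi>\<close> cannot be defined and plain, because they head a term that contains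
  the redex; this is why the invariant speaks of reducible terms rather than of redexes.
\<close>

lemma well_annotated_replace_at:
  assumes "well_annotated \<Sigma> R t" "\<pi> \<in> poss t" "reducible \<Sigma> R (flat t |_ \<pi>)"
    and "well_annotated \<Sigma> R u"
  shows "well_annotated \<Sigma> R (replace_at t \<pi> u)"
  using assms
proof (induction t \<pi> u rule: replace_at.induct)
  case (2 f ts i \<pi> u)
  have "reducible \<Sigma> R (flat (Fun f ts))"
    using reducible_subt_at[of "i # \<pi>" "flat (Fun f ts)" \<Sigma> R] "2.prems"(2,3)
    by simp
  then have "\<forall>g\<in>defined_syms R. f \<noteq> Plain g"
    using "2.prems"(1) by (simp only: well_annotated.simps) blast
  moreover have "well_annotated \<Sigma> R (replace_at (ts ! i) \<pi> u)"
    using 2 by auto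
  ultimately show ?case
    using "2.prems"(1) by (auto dest!: set_update_subset_insert[THEN subsetD])
qed auto

text \<open>Flattening forgets \<open>\<Phi>\<close>, so reducibility depends on
  \<open>flat t\<close> alone. The invariant thus becomes a lower bound on
  \<open>\<Phi>\<close>.\<close>

lemma well_annotated_annotate:
  assumes "\<And>\<pi> f ts. \<pi> \<in> poss t \<Longrightarrow> flat t |_ \<pi> = Fun f ts \<Longrightarrow> f \<in> defined_syms R \<Longrightarrow>
    reducible \<Sigma> R (flat t |_ \<pi>) \<Longrightarrow> \<pi> \<in> \<Phi>"
  shows "well_annotated \<Sigma> R (annotate \<Phi> t)"
  using assms
proof (induction t arbitrary: \<Phi>)
  case (Fun f ts)
  have "well_annotated \<Sigma> R (annotate {\<pi>. i # \<pi> \<in> \<Phi>} (ts ! i))" if "i < length ts" for i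
  proof (rule Fun.IH)
    fix \<pi> g us
    assume "\<pi> \<in> poss (ts ! i)" "flat (ts ! i) |_ \<pi> = Fun g us" "g \<in> defined_syms R"
      "reducible \<Sigma> R (flat (ts ! i) |_ \<pi>)"
    then show "\<pi> \<in> {\<pi>. i # \<pi> \<in> \<Phi>}" using that Fun.prems[of "i # \<pi>" g us] by auto
  qed (use that in simp)
  moreover have "\<not> reducible \<Sigma> R (flat (annotate \<Phi> (Fun f ts)))"
    if "[] \<notin> \<Phi>" "base f \<in> defined_syms R"
    using Fun.prems[of "[]"] that unfolding flat_annotate by auto
  ultimately show ?case by auto
qed simp

section \<open>Basic start terms satisfy the invariant\<close>

lemma constructor_term_root:
  "wf_term (\<Sigma> |` (- D)) t \<Longrightarrow> \<pi> \<in> poss t \<Longrightarrow> t |_ \<pi> = Fun f ts \<Longrightarrow> f \<notin> D"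
  by (drule (1) wf_term_subt_at) (auto simp: restrict_map_def split: if_splits)

lemma well_annotated_sharp_root:
  assumes "is_basic \<Sigma> (defined_syms R) t"
  shows "well_annotated \<Sigma> R (sharp_root t)"
proof -
  obtain f ts where t: "t = Fun f ts"
    and ts: "\<And>u. u \<in> set ts \<Longrightarrow> wf_term (\<Sigma> |` (- defined_syms R)) u"
    using assms by (auto simp: is_basic_def)
  have "well_annotated \<Sigma> R (plain u)" if "u \<in> set ts" for u
  proof -
    \<comment> \<open>Arguments of a basic term contain no defined symbols, so even the empty set of
      annotations suffices.\<close>
    have "well_annotated \<Sigma> R (annotate {} (plain u))"
      by (rule well_annotated_annotate)
        (metis constructor_term_root flat_plain poss_flat that ts)
    then show ?thesis by (simp add: plain_flat[symmetric] flat_plain)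
  qed
  with t show ?thesis by auto
qed

lemma wf_sharp_root:
  assumes "is_basic \<Sigma> D t"
  shows "wf_term (sharp_sig \<Sigma> D) (sharp_root t)"
proof -
  obtain f ts where t: "t = Fun f ts" "f \<in> D" "wf_term \<Sigma> t"
    using assms by (auto simp: is_basic_def)
  have "wf_term (sharp_sig \<Sigma> D) (plain u)" if "u \<in> set ts" for u
    using wf_annotate_plain[of \<Sigma> u "{}" D] t that by (simp add: plain_flat[symmetric] flat_plain)
  with t show ?thesis by (auto simp: sharp_sig_def)
qed


section \<open>Lifting a rewrite step\<close>

lemma occs_flat: "occs x (flat t) = occs x t"
proof -
  have "flat t |_ \<pi> = Var x \<longleftrightarrow> t |_ \<pi> = Var x" if "\<pi> \<in> poss t" for \<pi>
    unfolding flat_subt_at[OF that] by (cases "t |_ \<pi>") simp_all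
  then show ?thesis by (simp add: occs_def cong: conj_cong)
qed

text \<open>If \<open>x\<close> occurs in \<open>r\<close> at most as often as in \<open>l\<close>,
  its occurrences in \<open>r\<close> inject into those in \<open>l\<close>. Inverting these
  injections gives a partial map that reaches every occurrence of such an \<open>x\<close> in
  \<open>r\<close>.\<close>

lemma surjective_vrf:
  fixes l :: "('f, 'v) term" and r :: "('f asym, 'v) term"
  obtains \<phi> where "is_vrf l r \<phi>"
    and "\<And>x \<pi>. \<pi> \<in> poss r \<Longrightarrow> r |_ \<pi> = Var x \<Longrightarrow> occs x r \<le> occs x l \<Longrightarrow>
      \<exists>\<rho>\<in>poss l. l |_ \<rho> = Var x \<and> \<phi> \<rho> = Some \<pi>"
proof -
  define L where "L x = {\<pi> \<in> poss l. l |_ \<pi> = Var x}" for x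
  define K where "K x = {\<pi> \<in> poss r. r |_ \<pi> = Var x}" for x
  have "\<exists>h. h ` K x \<subseteq> L x \<and> inj_on h (K x)" if "occs x r \<le> occs x l" for x
  proof (rule card_le_inj)
    show "finite (K x)" "finite (L x)" by (simp_all add: K_def L_def finite_poss)
    show "card (K x) \<le> card (L x)" using that by (simp add: K_def L_def occs_def)
  qed
  then obtain h where h: "h x ` K x \<subseteq> L x" "inj_on (h x) (K x)" if "occs x r \<le> occs x l" for x
    by metis
  \<comment> \<open>The value \<open>None\<close> is taken outside the image of the injection, in
    particular at all occurrences of a variable that is more frequent in \<open>r\<close>.\<close>
  define \<phi> where "\<phi> \<rho> = (case l |_ \<rho> of
      Var x \<Rightarrow> if occs x r \<le> occs x l \<and> \<rho> \<in> h x ` K x then Some (inv_into (K x) (h x) \<rho>) else None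
    | Fun f ts \<Rightarrow> None)" for \<rho>
  have "is_vrf l r \<phi>"
    unfolding is_vrf_def
  proof (intro ballI allI impI)
    fix \<rho> \<pi> assume "\<rho> \<in> var_poss l" and \<phi>: "\<phi> \<rho> = Some \<pi>"
    then obtain x where x: "l |_ \<rho> = Var x" by (auto simp: var_poss_def)
    with \<phi> have "\<pi> \<in> K x" by (auto simp: \<phi>_def inv_into_into split: if_splits)
    with x show "\<pi> \<in> var_poss r \<and> plain (l |_ \<rho>) = r |_ \<pi>"
      by (auto simp: K_def var_poss_def)
  qed
  moreover have "\<exists>\<rho>\<in>poss l. l |_ \<rho> = Var x \<and> \<phi> \<rho> = Some \<pi>"
    if "\<pi> \<in> poss r" "r |_ \<pi> = Var x" and le: "occs x r \<le> occs x l" for x \<pi>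
  proof -
    have \<pi>: "\<pi> \<in> K x" using that by (simp add: K_def)
    with h(1)[OF le] have "h x \<pi> \<in> poss l" "l |_ (h x \<pi>) = Var x" by (auto simp: L_def)
    moreover from this have "\<phi> (h x \<pi>) = Some \<pi>"
      using \<pi> le h(2)[OF le] by (simp add: \<phi>_def)
    ultimately show ?thesis by blast
  qed
  ultimately show thesis using that by blast
qed

lemma flat_adp_result:
  assumes "\<pi> \<in> poss s" "c \<noteq> AF"
  shows "flat (adp_result D c s \<pi> l \<sigma> \<phi> r) = replace_at (flat s) \<pi> (flat r \<cdot> \<sigma>)"
  using assms by (cases c) (auto simp: flat_replace_at flat_subst)

text \<open>Preservation of the invariant. A defined symbol heading a reducible subterm of the
  contractum either stems from \<open>r0\<close>, where the canonical ADP annotates it, or lies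
  inside some \<open>\<sigma> x\<close>. Then \<open>\<sigma> x\<close> is reducible, so by
  \<open>spare\<close> the reposition function reaches this occurrence of \<open>x\<close>, and the
  annotation is copied from the redex.\<close>

lemma adp_result_AT:
  fixes \<Sigma> :: "'f sig" and R :: "('f, 'v) ptrs"
  defines "D \<equiv> defined_syms R"
  assumes s: "well_annotated \<Sigma> R s" "wf_term (sharp_sig \<Sigma> D) s"
    and \<pi>: "\<pi> \<in> poss s" "flat s |_ \<pi> = l \<cdot> \<sigma>" "reducible \<Sigma> R (flat s |_ \<pi>)"
    and r: "r = annotate (sym_poss D r0) (plain r0)"
    and wf: "wf_term \<Sigma> r0" "\<forall>x. wf_term \<Sigma> (\<sigma> x)"
    and vrf: "is_vrf l r \<phi>"
    and onto: "\<And>x \<pi>. \<pi> \<in> poss r \<Longrightarrow> r |_ \<pi> = Var x \<Longrightarrow> occs x r \<le> occs x l \<Longrightarrow>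
      \<exists>\<rho>\<in>poss l. l |_ \<rho> = Var x \<and> \<phi> \<rho> = Some \<pi>"
    and spare: "\<And>x. occs x l < occs x r0 \<Longrightarrow> \<not> reducible \<Sigma> R (\<sigma> x)"
  shows "well_annotated \<Sigma> R (adp_result D AT s \<pi> l \<sigma> \<phi> r)"
    and "wf_term (sharp_sig \<Sigma> D) (adp_result D AT s \<pi> l \<sigma> \<phi> r)"
proof -
  let ?u = "s |_ \<pi>"
  let ?\<Phi> = "Phi_set D l r \<phi> ?u"
  have flat_r: "flat r = r0" by (simp add: r flat_plain)
  have flat_u: "flat ?u = l \<cdot> \<sigma>" using \<pi> by (simp add: flat_subt_at)
  have u: "well_annotated \<Sigma> R ?u" using s(1) \<pi>(1) by (rule well_annotated_subt_at)
  have flat_t: "flat (r \<cdot> (plain \<circ> \<sigma>)) = r0 \<cdot> \<sigma>" by (simp add: flat_subst flat_r)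
  \<comment> \<open>Only defined symbols have annotated copies in \<open>sharp_sig\<close>, hence
    this inclusion is what well-formedness requires.\<close>
  have "?\<Phi> \<subseteq> sym_poss D (flat (r \<cdot> (plain \<circ> \<sigma>)))"
    using Psi_set_sym_poss[OF vrf flat_u] sym_poss_flat[of _ D r]
    unfolding flat_t Phi_set_def by (auto simp: flat_r intro: sym_poss_subst)
  then have "wf_term (sharp_sig \<Sigma> D) (annotate ?\<Phi> (r \<cdot> (plain \<circ> \<sigma>)))"
    by (intro wf_annotate) (simp_all add: flat_t wf_term_subst wf)
  then show "wf_term (sharp_sig \<Sigma> D) (adp_result D AT s \<pi> l \<sigma> \<phi> r)"
    using s(2) \<pi>(1) by (simp add: wf_term_replace_at)
  have "well_annotated \<Sigma> R (annotate ?\<Phi> (r \<cdot> (plain \<circ> \<sigma>)))"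
  proof (rule well_annotated_annotate, unfold flat_t)
    fix \<tau> f ts
    assume \<tau>: "\<tau> \<in> poss (r \<cdot> (plain \<circ> \<sigma>))" and f: "(r0 \<cdot> \<sigma>) |_ \<tau> = Fun f ts" "f \<in> defined_syms R"
      and red: "reducible \<Sigma> R ((r0 \<cdot> \<sigma>) |_ \<tau>)"
    have "\<tau> \<in> poss (r0 \<cdot> \<sigma>)" using \<tau> flat_t poss_flat by metis
    then show "\<tau> \<in> ?\<Phi>"
    proof (cases rule: poss_subst_cases)
      case (inside g us)
      with f have "f = g" by (simp add: subt_at_subst)
      moreover have "plain r0 |_ \<tau> = Fun (Plain g) (map plain us)"
        using inside by (induction r0 \<tau> rule: subt_at.induct) auto
      moreover have "\<tau> \<in> poss (plain r0)"
        using inside poss_flat[of "plain r0"] by (simp add: flat_plain)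
      ultimately have "\<tau> \<in> sym_poss (Sharp ` D) r"
        using inside f(2) root_annotate[of \<tau> "plain r0" "Plain g" "map plain us" "sym_poss D r0"]
        by (auto simp: r D_def sym_poss_def)
      then show ?thesis by (simp add: Phi_set_def)
    next
      case (below x \<kappa> \<tau>')
      then have \<kappa>: "(r0 \<cdot> \<sigma>) |_ \<tau> = \<sigma> x |_ \<tau>'"
        by (simp add: subt_at_append[OF poss_subst] subt_at_subst)
      with red below have "reducible \<Sigma> R (\<sigma> x)" by (auto intro: reducible_subt_at)
      with spare have "occs x r \<le> occs x l"
        by (metis not_less occs_flat flat_r)
      moreover have "\<kappa> \<in> poss r" "r |_ \<kappa> = Var x"
        using below flat_subt_at[of \<kappa> r] poss_flat[of r] by (cases "r |_ \<kappa>"; simp add: flat_r)+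
      ultimately obtain \<rho> where \<rho>: "\<rho> \<in> poss l" "l |_ \<rho> = Var x" "\<phi> \<rho> = Some \<kappa>"
        using onto by blast
      \<comment> \<open>The same reducible subterm already sits in the redex below
        \<open>\<rho>\<close>, so the invariant for \<open>?u\<close> supplies its
        annotation.\<close>
      have "\<rho> @ \<tau>' \<in> poss (flat ?u)" "flat ?u |_ (\<rho> @ \<tau>') = (r0 \<cdot> \<sigma>) |_ \<tau>"
        using \<rho> below
        by (simp_all add: \<kappa> flat_u poss_append[OF poss_subst] subt_at_append[OF poss_subst]
            subt_at_subst)
      then have "\<rho> @ \<tau>' \<in> sym_poss (Sharp ` D) ?u"
        using f red well_annotated_sharp[OF u, of "\<rho> @ \<tau>'"] by (simp add: D_def)
      with \<rho> below show ?thesis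
        by (auto simp: Phi_set_def Psi_set_def var_poss_def)
    qed
  qed
  then show "well_annotated \<Sigma> R (adp_result D AT s \<pi> l \<sigma> \<phi> r)"
    using s(1) \<pi> by (simp add: well_annotated_replace_at)
qed

text \<open>Pulls an enumeration of the image back to one of \<open>M\<close>; this lets the order
  of the children of a node dictate the order of the right-hand sides.\<close>

lemma image_mset_eq_msetE:
  assumes "image_mset g M = mset xs"
  obtains ms where "mset ms = M" "map g ms = xs"
  using assms
proof (induction xs arbitrary: M thesis)
  case (Cons x xs)
  then obtain M' m where "M = add_mset m M'" "g m = x" "image_mset g M' = mset xs"
    by (metis msed_map_invR mset.simps(2))
  moreover from this(3) obtain ms where "mset ms = M'" "map g ms = xs"
    using Cons.IH by blast
  ultimately show ?case using Cons.prems(1)[of "m # ms"] by simp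
qed simp

text \<open>Here \<open>W\<close> is the set of children, \<open>q\<close> gives the transition
  probabilities and \<open>t\<close> the labels. The new labels \<open>h\<close> must belong to
  individual children, whereas a step speaks only of multisets; hence children and right-hand sides
  are first aligned as lists.\<close>

lemma lift_step:
  fixes \<Sigma> :: "'f sig" and R :: "('f, 'v) ptrs"
  defines "D \<equiv> defined_syms R"
  assumes R: "is_ptrs \<Sigma> R" "\<rho> \<in> R"
    and step: "prewrite_with \<Sigma> \<rho> \<sigma> \<pi> (flat u) (image_mset (\<lambda>w. (q w, t w)) (mset_set W))"
    and spare: "weakly_spare_step \<Sigma> R \<rho> \<sigma>"
    and u: "wf_term (sharp_sig \<Sigma> D) u" "well_annotated \<Sigma> R u"
    and W: "finite W"
  obtains h where
    "adp_step \<Sigma> D (canonical_adp D \<rho>) AT u (image_mset (\<lambda>w. (q w, h w)) (mset_set W))"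
    and "\<And>w. w \<in> W \<Longrightarrow> flat (h w) = t w \<and> wf_term (sharp_sig \<Sigma> D) (h w) \<and> well_annotated \<Sigma> R (h w)"
proof -
  obtain l \<mu> where \<rho>: "\<rho> = (l, \<mu>)" by (cases \<rho>)
  have \<sigma>: "is_subst \<Sigma> \<sigma>" and \<pi>: "\<pi> \<in> poss u" "flat u |_ \<pi> = l \<cdot> \<sigma>"
    and M: "image_mset (\<lambda>w. (q w, t w)) (mset_set W) =
      image_mset (\<lambda>(p, r). (p, replace_at (flat u) \<pi> (r \<cdot> \<sigma>))) \<mu>"
    using step by (auto simp: prewrite_with_def \<rho>)
  have red: "reducible \<Sigma> R (flat u |_ \<pi>)"
    unfolding reducible_iff using R(2) \<sigma>
    by (intro bexI[of _ \<rho>]) (auto simp: \<rho> \<pi>(2) intro!: exI[of _ \<sigma>] bexI[of _ "[]"])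
  obtain f ts where l: "l = Fun f ts"
    using R by (cases l) (auto simp: is_ptrs_def is_prule_def \<rho>)
  with R(2) have f: "f \<in> D" by (auto simp: D_def defined_syms_def \<rho>)
  have sharp: "\<pi> \<in> sym_poss (Sharp ` D) u"
    unfolding D_def by (rule well_annotated_sharp[OF u(2) \<pi>(1) red]) (use \<pi> l f D_def in auto)
  obtain ws where ws: "set ws = W" "distinct ws" using W finite_distinct_list by blast
  then have ws': "mset_set W = mset ws" using mset_set_set by blast
  obtain ms where ms: "mset ms = \<mu>"
    "map (\<lambda>(p, r). (p, replace_at (flat u) \<pi> (r \<cdot> \<sigma>))) ms = map (\<lambda>w. (q w, t w)) ws"
    using image_mset_eq_msetE[of _ \<mu> "map (\<lambda>w. (q w, t w)) ws"] M ws' by auto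
  define n where "n = length ms"
  have n: "length ws = n" using arg_cong[OF ms(2), of length] by (simp add: n_def)
  have ms_nth: "fst (ms ! j) = q (ws ! j)" "replace_at (flat u) \<pi> (snd (ms ! j) \<cdot> \<sigma>) = t (ws ! j)"
    if "j < n" for j
    using arg_cong[OF ms(2), of "\<lambda>xs. xs ! j"] that n by (simp_all add: n_def case_prod_unfold)
  define rs where "rs = map (\<lambda>(p, r). (p, annotate (sym_poss D r) (plain r))) ms"
  have rs_nth: "fst (rs ! j) = q (ws ! j)"
    "snd (rs ! j) = annotate (sym_poss D (snd (ms ! j))) (plain (snd (ms ! j)))"
    if "j < n" for j
    using that by (simp_all add: rs_def n_def case_prod_unfold ms_nth(1)[unfolded n_def])
  have "\<exists>\<phi>. is_vrf l r \<phi> \<and> (\<forall>x \<pi>. \<pi> \<in> poss r \<longrightarrow> r |_ \<pi> = Var x \<longrightarrow> occs x r \<le> occs x l \<longrightarrow>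
      (\<exists>\<rho>\<in>poss l. l |_ \<rho> = Var x \<and> \<phi> \<rho> = Some \<pi>))" for r :: "('f asym, 'v) term"
    by (rule surjective_vrf[of l r]) blast
  \<comment> \<open>One reposition function is fixed per right-hand side; equal right-hand sides
    share it.\<close>
  then obtain \<Theta> where \<Theta>: "is_vrf l r (\<Theta> r)"
    "\<And>x \<pi>. \<pi> \<in> poss r \<Longrightarrow> r |_ \<pi> = Var x \<Longrightarrow> occs x r \<le> occs x l \<Longrightarrow>
      \<exists>\<rho>\<in>poss l. l |_ \<rho> = Var x \<and> \<Theta> r \<rho> = Some \<pi>" for r :: "('f asym, 'v) term"
    by metis
  define res where "res j = adp_result D AT u \<pi> l \<sigma> (\<Theta> (snd (rs ! j))) (snd (rs ! j))" for j
  \<comment> \<open>The lookup is unambiguous because \<open>ws\<close> is distinct; the values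
    outside \<open>W\<close> are irrelevant.\<close>
  define h where "h w = the (map_of (zip ws (map res [0..<n])) w)" for w
  have h: "h (ws ! j) = res j" if "j < n" for j
    using that n ws(2) by (simp add: h_def map_of_zip_nth)
  have "map (\<lambda>w. (q w, h w)) ws = map (\<lambda>j. (fst (rs ! j), res j)) [0..<n]"
    by (rule nth_equalityI) (simp_all add: n h rs_nth)
  then have "image_mset (\<lambda>w. (q w, h w)) (mset_set W) =
      mset (map (\<lambda>j. (fst (rs ! j), res j)) [0..<length rs])"
    by (simp add: ws' rs_def n_def flip: mset_map)
  moreover have "mset rs = image_mset (\<lambda>(p, r). (p, annotate (sym_poss D r) (plain r))) \<mu>"
    by (simp add: rs_def ms(1)[symmetric])
  moreover have "\<pi> \<in> sym_poss (Plain ` D \<union> Sharp ` D) u" using sharp by (auto simp: sym_poss_def)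
  ultimately have "adp_step \<Sigma> D (canonical_adp D \<rho>) AT u (image_mset (\<lambda>w. (q w, h w)) (mset_set W))"
    unfolding adp_step_def canonical_adp_def \<rho> prod.case
    using \<Theta>(1) \<sigma> \<pi> sharp
    by (intro exI[of _ rs] exI[of _ "\<lambda>j. \<Theta> (snd (rs ! j))"] exI[of _ \<sigma>] exI[of _ \<pi>])
      (simp add: res_def flat_subt_at)
  moreover have "flat (h w) = t w \<and> wf_term (sharp_sig \<Sigma> D) (h w) \<and> well_annotated \<Sigma> R (h w)"
    if w: "w \<in> W" for w
  proof -
    obtain j where j: "j < n" "w = ws ! j" using w ws(1) n by (metis in_set_conv_nth)
    define r0 where "r0 = snd (ms ! j)"
    have r0: "r0 \<in># Supp \<mu>"
      using j(1) by (auto simp: Supp_def ms(1)[symmetric] r0_def n_def)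
    have wf: "wf_term \<Sigma> r0" "\<forall>x. wf_term \<Sigma> (\<sigma> x)"
      using R r0 \<sigma> by (auto simp: is_ptrs_def is_prule_def is_subst_def \<rho>)
    have NF: "\<not> reducible \<Sigma> R (\<sigma> x)" if "occs x l < occs x r0" for x
      using spare that r0 by (auto simp: weakly_spare_step_def \<rho> NF_iff)
    note rs_j = rs_nth(2)[OF j(1), folded r0_def]
    note result = adp_result_AT[OF u(2) u(1)[unfolded D_def] \<pi> red rs_j[unfolded D_def] wf \<Theta>]
    have "well_annotated \<Sigma> R (res j)" "wf_term (sharp_sig \<Sigma> D) (res j)"
      unfolding res_def D_def using result NF by blast+
    moreover have "flat (res j) = t w"
      using j ms_nth(2) \<pi>(1) by (simp add: res_def flat_adp_result rs_nth(2) flat_plain del: adp_result.simps)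
    ultimately show ?thesis using j h by simp
  qed
  ultimately show thesis using that by blast
qed

text \<open>Matching is defined on flattened terms, and \<open>AT\<close> and \<open>NT\<close>
  steps differ only in annotations. Forgetting them leaves a step with the same rule, substitution
  and position.\<close>

lemma flat_step:
  assumes step: "adp_step \<Sigma> D (canonical_adp D \<rho>) c u M" and "\<rho> \<in> R"
  shows "prewrite \<Sigma> R (flat u) (image_mset (\<lambda>(p, t). (p, flat t)) M)"
proof -
  obtain l \<mu> where \<rho>: "\<rho> = (l, \<mu>)" by (cases \<rho>)
  obtain rs \<phi> \<sigma> \<pi>
    where rs: "mset rs = image_mset (\<lambda>(p, r). (p, annotate (sym_poss D r) (plain r))) \<mu>"
      and \<sigma>: "is_subst \<Sigma> \<sigma>" and \<pi>: "\<pi> \<in> poss u" "flat (u |_ \<pi>) = l \<cdot> \<sigma>"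
      and c: "case_applies D c u \<pi> True"
      and M: "M = mset (map (\<lambda>j. (fst (rs ! j), adp_result D c u \<pi> l \<sigma> (\<phi> j) (snd (rs ! j))))
        [0..<length rs])"
    using step by (auto simp: adp_step_def canonical_adp_def \<rho> sym_poss_def)
  \<comment> \<open>Canonical ADPs carry the flag \<open>True\<close>.\<close>
  from c have "c \<noteq> AF" by auto
  with \<pi> have "image_mset (\<lambda>(p, t). (p, flat t)) M =
      mset (map (\<lambda>j. (fst (rs ! j), replace_at (flat u) \<pi> (flat (snd (rs ! j)) \<cdot> \<sigma>)))
        [0..<length rs])"
    by (simp add: M flat_adp_result image_mset.compositionality comp_def flip: mset_map
        del: adp_result.simps)
  also have "map (\<lambda>j. (fst (rs ! j), replace_at (flat u) \<pi> (flat (snd (rs ! j)) \<cdot> \<sigma>))) [0..<length rs]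
      = map (\<lambda>(p, r). (p, replace_at (flat u) \<pi> (flat r \<cdot> \<sigma>))) rs"
    by (rule nth_equalityI) (simp_all add: case_prod_unfold)
  also have "mset \<dots> = image_mset (\<lambda>(p, r). (p, replace_at (flat u) \<pi> (r \<cdot> \<sigma>))) \<mu>"
    by (simp add: rs image_mset.compositionality comp_def case_prod_unfold flat_plain)
  finally have "prewrite_with \<Sigma> \<rho> \<sigma> \<pi> (flat u) (image_mset (\<lambda>(p, t). (p, flat t)) M)"
    using \<sigma> \<pi> by (simp add: prewrite_with_def \<rho> flat_subt_at)
  with assms(2) show ?thesis by (auto simp: prewrite_def)
qed


section \<open>Relabeling trees\<close>

text \<open>The graph of a function defined by recursion from the root: \<open>F\<close> receives a
  node, its value and a child, and returns the value of the child.\<close>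

inductive path_value :: "'n rel \<Rightarrow> 'n \<Rightarrow> 'a \<Rightarrow> ('n \<Rightarrow> 'a \<Rightarrow> 'n \<Rightarrow> 'a) \<Rightarrow> 'n \<Rightarrow> 'a \<Rightarrow> bool"
  for E r a F where
  root: "path_value E r a F r a"
| edge: "path_value E r a F v b \<Longrightarrow> (v, w) \<in> E \<Longrightarrow> path_value E r a F w (F v b w)"

text \<open>The root has no predecessor and any other node only one, so the last rule of a
  derivation is forced.\<close>

lemma path_value_unique:
  assumes "directed_tree V E r"
  shows "path_value E r a F v b \<Longrightarrow> path_value E r a F v b' \<Longrightarrow> b = b'"
proof (induction arbitrary: b' rule: path_value.induct)
  case root
  have "(u, r) \<notin> E" for u using assms by (simp add: directed_tree_def)
  with root show ?case by (blast elim: path_value.cases)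
next
  case (edge v b w)
  have parent: "v' = v" if "(v', w) \<in> E" for v'
    using assms that edge.hyps(2) unfolding directed_tree_def by blast
  have "w \<noteq> r" using assms edge.hyps(2) unfolding directed_tree_def by blast
  with edge.prems obtain v' b'' where "path_value E r a F v' b''" "(v', w) \<in> E" "b' = F v' b'' w"
    by (blast elim: path_value.cases)
  with parent edge.IH show ?case by blast
qed

text \<open>Reachability from the root gives existence of a value, unique parents give uniqueness.
  It is applied to depths and to annotated labels.\<close>

lemma directed_tree_recursion:
  assumes "directed_tree V E r"
  obtains f where "f r = a" "\<And>v w. (v, w) \<in> E \<Longrightarrow> f w = F v (f v) w"
proof -
  define f where "f v = (THE b. path_value E r a F v b)" for v
  have f: "f v = b" if "path_value E r a F v b" for v b
    unfolding f_def using that by (rule the_equality) (rule path_value_unique[OF assms _ that])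
  have path: "path_value E r a F v (f v)" if "(r, v) \<in> E\<^sup>*" for v
    using that
  proof induction
    case base
    show ?case using path_value.root[of E r a F] f by metis
  next
    case (step v w)
    show ?case using path_value.edge[OF step.IH step.hyps(2)] f by metis
  qed
  have "f w = F v (f v) w" if "(v, w) \<in> E" for v w
  proof -
    have "(r, v) \<in> E\<^sup>*" using assms that by (auto simp: directed_tree_def)
    then show ?thesis by (intro f path_value.edge[OF path that])
  qed
  with that f[OF path_value.root] show thesis by blast
qed

text \<open>The depth grows by one along each edge, so no node repeats on a path.\<close>

lemma directed_tree_path_inj:
  assumes "directed_tree V E r" and "\<And>i. (f i, f (Suc i)) \<in> E"
  shows "inj f"
proof -
  obtain d :: "_ \<Rightarrow> nat" where d: "\<And>v w. (v, w) \<in> E \<Longrightarrow> d w = Suc (d v)"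
    using directed_tree_recursion[OF assms(1), of 0 "\<lambda>v n w. Suc n"] by metis
  have "d (f i) = d (f 0) + i" for i
    by (induction i) (simp_all add: d[OF assms(2)])
  then show ?thesis by (metis add_left_cancel injI)
qed

definition relabel :: "('n \<Rightarrow> 'u) \<Rightarrow> ('n, 't) ltree \<Rightarrow> ('n, 'u) ltree" where
  "relabel f T = \<lparr>nodes = nodes T, edges = edges T, prob = prob T, lab = f\<rparr>"

lemma relabel_simps [simp]:
  "nodes (relabel f T) = nodes T" "edges (relabel f T) = edges T"
  "prob (relabel f T) = prob T" "lab (relabel f T) = f"
  "inner_nodes (relabel f T) = inner_nodes T"
  "leaf_mass (relabel f T) = leaf_mass T"
  "is_ltree (relabel f T) r \<longleftrightarrow> is_ltree T r"
  by (simp_all add: relabel_def inner_nodes_def leaf_mass_def leaves_def is_ltree_def)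

lemma succ_mdist_relabel:
  "succ_mdist (relabel f T) v =
     image_mset (\<lambda>w. (prob T w / prob T v, f w)) (mset_set (edges T `` {v}))"
  by (simp add: succ_mdist_def)

section \<open>Translations between chain trees and rewrite sequence trees\<close>

lemma flatten_chain_tree:
  assumes "is_chain_tree \<Sigma> (defined_syms R) (DP R) T r A \<alpha>"
  shows "is_rst \<Sigma> R (relabel (flat \<circ> lab T) T) r"
proof -
  have "prewrite \<Sigma> R (flat (lab T v)) (succ_mdist (relabel (flat \<circ> lab T) T) v)"
    if v: "v \<in> inner_nodes T" for v
  proof -
    obtain \<rho> c where "\<rho> \<in> R"
      "adp_step \<Sigma> (defined_syms R) (canonical_adp (defined_syms R) \<rho>) c (lab T v) (succ_mdist T v)"
      using assms v unfolding is_chain_tree_def DP_def by (metis imageE)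
    from flat_step[OF this(2,1)] show ?thesis
      by (simp add: succ_mdist_def image_mset.compositionality comp_def)
  qed
  then show ?thesis
    using assms by (auto simp: is_rst_def is_chain_tree_def intro: wf_term_flat)
qed

text \<open>The label of a node determines, through \<open>lift_step\<close>, possible labels for
  all its children at once; choosing such labels is iterated by recursion along the tree.\<close>

lemma annotate_rst:
  fixes \<Sigma> :: "'f sig" and R :: "('f, 'v) ptrs"
  assumes R: "is_ptrs \<Sigma> R" and T: "is_rst \<Sigma> R T r" "weakly_spare_rst \<Sigma> R T"
    and basic: "is_basic \<Sigma> (defined_syms R) (lab T r)"
  obtains f \<alpha> where
    "is_chain_tree \<Sigma> (defined_syms R) (DP R) (relabel f T) r (inner_nodes T) \<alpha>"
    and "f r = sharp_root (lab T r)"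
proof -
  define D where "D = defined_syms R"
  define good where "good v u \<longleftrightarrow>
    flat u = lab T v \<and> wf_term (sharp_sig \<Sigma> D) u \<and> well_annotated \<Sigma> R u" for v u
  \<comment> \<open>\<open>h\<close> is a total labeling for convenience; only its values at the
    children of \<open>v\<close> matter.\<close>
  define ok where "ok v u h \<longleftrightarrow>
    (\<exists>d\<in>DP R. adp_step \<Sigma> D d AT u (succ_mdist (relabel h T) v)) \<and>
    (\<forall>w. (v, w) \<in> edges T \<longrightarrow> good w (h w))" for v u h
  have tree: "directed_tree (nodes T) (edges T) r" and fin: "finite (edges T `` {v})" for v
    using T(1) by (auto simp: is_rst_def is_ltree_def)
  have ex_ok: "\<exists>h. ok v u h" if v: "v \<in> inner_nodes T" and u: "good v u" for v u
  proof -
    obtain \<rho> \<sigma> \<pi> where \<rho>: "\<rho> \<in> R" and step: "prewrite_with \<Sigma> \<rho> \<sigma> \<pi> (lab T v) (succ_mdist T v)"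
      using T(1) v by (auto simp: is_rst_def prewrite_def)
    have spare: "weakly_spare_step \<Sigma> R \<rho> \<sigma>"
      using T(2) v \<rho> step by (auto simp: weakly_spare_rst_def)
    have step': "prewrite_with \<Sigma> \<rho> \<sigma> \<pi> (flat u)
        (image_mset (\<lambda>w. (prob T w / prob T v, lab T w)) (mset_set (edges T `` {v})))"
      using step u by (simp add: good_def succ_mdist_def)
    have u': "wf_term (sharp_sig \<Sigma> (defined_syms R)) u" "well_annotated \<Sigma> R u"
      using u by (simp_all add: good_def D_def)
    obtain h where "adp_step \<Sigma> D (canonical_adp D \<rho>) AT u
          (image_mset (\<lambda>w. (prob T w / prob T v, h w)) (mset_set (edges T `` {v})))"
      "\<And>w. w \<in> edges T `` {v} \<Longrightarrow>
        flat (h w) = lab T w \<and> wf_term (sharp_sig \<Sigma> D) (h w) \<and> well_annotated \<Sigma> R (h w)"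
      unfolding D_def by (rule lift_step[OF R \<rho> step' spare u' fin]) blast
    with \<rho> have "ok v u h"
      by (auto simp: ok_def good_def succ_mdist_relabel DP_def D_def)
    then show ?thesis by blast
  qed
  \<comment> \<open>The chosen \<open>h\<close> depends on \<open>v\<close> and \<open>f v\<close>
    but not on the child \<open>w\<close>, so siblings get labels from the same step.\<close>
  obtain f where f_root: "f r = sharp_root (lab T r)"
    and f_edge: "\<And>v w. (v, w) \<in> edges T \<Longrightarrow> f w = (SOME h. ok v (f v) h) w"
    by (rule directed_tree_recursion[OF tree, of "sharp_root (lab T r)" "\<lambda>v u. SOME h. ok v u h"])
      (rule that)
  \<comment> \<open>The choice is meaningful at \<open>v\<close> only if \<open>f v\<close> is
    \<open>good\<close>, and it then makes the children \<open>good\<close>; hence an induction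
    along the path from the root.\<close>
  have "good v (f v)" if "(r, v) \<in> (edges T)\<^sup>*" for v
    using that
  proof induction
    case base
    show ?case
      using well_annotated_sharp_root[OF basic] wf_sharp_root[OF basic]
      by (simp add: good_def f_root flat_sharp_root D_def)
  next
    case (step v w)
    then have "v \<in> inner_nodes T" using tree by (auto simp: inner_nodes_def directed_tree_def)
    from someI_ex[OF ex_ok[OF this step.IH]] step.hyps f_edge show ?case
      by (simp add: ok_def)
  qed
  then have good: "good v (f v)" if "v \<in> nodes T" for v
    using that tree by (auto simp: directed_tree_def)
  have "\<exists>d\<in>DP R. adp_step \<Sigma> D d AT (f v) (succ_mdist (relabel f T) v)"
    if v: "v \<in> inner_nodes T" for v
  proof -
    have "good v (f v)" using v good by (simp add: inner_nodes_def)
    from someI_ex[OF ex_ok[OF v this]]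
    have "\<exists>d\<in>DP R. adp_step \<Sigma> D d AT (f v) (succ_mdist (relabel (SOME h. ok v (f v) h) T) v)"
      by (simp add: ok_def)
    \<comment> \<open>By \<open>f_edge\<close>, the locally chosen labeling and \<open>f\<close>
      agree on the children of \<open>v\<close>.\<close>
    moreover have "succ_mdist (relabel (SOME h. ok v (f v) h) T) v = succ_mdist (relabel f T) v"
      unfolding succ_mdist_relabel using f_edge fin by (intro image_mset_cong) auto
    ultimately show ?thesis by simp
  qed
  then obtain \<alpha> where \<alpha>:
    "\<And>v. v \<in> inner_nodes T \<Longrightarrow> \<alpha> v \<in> DP R \<and> adp_step \<Sigma> D (\<alpha> v) AT (f v) (succ_mdist (relabel f T) v)"
    by metis
  \<comment> \<open>An infinite path consists of inner nodes only and is injective.\<close>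
  moreover have "infinite (range g \<inter> inner_nodes T)" if g: "\<forall>i. (g i, g (Suc i)) \<in> edges T"
    for g :: "nat \<Rightarrow> _"
  proof -
    have "g i \<in> inner_nodes T" for i
      using spec[OF g, of i] tree by (auto simp: inner_nodes_def directed_tree_def)
    then have "range g \<subseteq> inner_nodes T" by blast
    moreover have "infinite (range g)"
      using directed_tree_path_inj[OF tree] g range_inj_infinite by blast
    ultimately show ?thesis by (simp add: Int_absorb2)
  qed
  moreover have "wf_term (sharp_sig \<Sigma> D) (f v)" if "v \<in> nodes T" for v
    using good[OF that] by (simp add: good_def)
  moreover have "is_ltree T r" using T(1) by (simp add: is_rst_def)
  ultimately have "is_chain_tree \<Sigma> D (DP R) (relabel f T) r (inner_nodes T) \<alpha>"
    unfolding is_chain_tree_def relabel_simps by blast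
  then show thesis using that f_root unfolding D_def by blast
qed

theorem theorem14:
  fixes \<Sigma> :: "'f sig" and R :: "('f, 'v) ptrs"
  assumes "finite (dom \<Sigma>)"
    and "is_ptrs \<Sigma> R"
    and "weakly_spare \<Sigma> R"
  shows "bAST \<Sigma> R \<longleftrightarrow> adp_bAST \<Sigma> (defined_syms R) ({}, DP R)"
proof
  assume bAST: "bAST \<Sigma> R"
  show "adp_bAST \<Sigma> (defined_syms R) ({}, DP R)"
    unfolding adp_bAST_def prod.case
  proof (intro allI impI, elim conjE exE)
    fix T :: "(nat, ('f asym, 'v) term) ltree" and r A \<alpha> t
    assume "is_chain_tree \<Sigma> (defined_syms R) ({} \<union> DP R) T r A \<alpha>"
      and "is_basic \<Sigma> (defined_syms R) t" "lab T r = sharp_root t"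
    then have "leaf_mass (relabel (flat \<circ> lab T) T) = 1"
      using bAST flatten_chain_tree[of \<Sigma> R T r A \<alpha>] unfolding bAST_def
      by (metis Un_empty_left comp_apply flat_sharp_root relabel_simps(4))
    then show "leaf_mass T = 1" by simp
  qed
next
  assume adp: "adp_bAST \<Sigma> (defined_syms R) ({}, DP R)"
  show "bAST \<Sigma> R"
    unfolding bAST_def
  proof (intro allI impI, elim conjE)
    fix T :: "(nat, ('f, 'v) term) ltree" and r
    assume T: "is_rst \<Sigma> R T r" and basic: "is_basic \<Sigma> (defined_syms R) (lab T r)"
    then have "weakly_spare_rst \<Sigma> R T" using assms(3) by (auto simp: weakly_spare_def)
    then obtain f \<alpha> where
      "is_chain_tree \<Sigma> (defined_syms R) (DP R) (relabel f T) r (inner_nodes T) \<alpha>"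
      "f r = sharp_root (lab T r)"
      using annotate_rst[OF assms(2) T _ basic] by blast
    \<comment> \<open>With an empty first component no node uses an ADP from \<open>I - P\<close>,
      so the finiteness condition holds.\<close>
    with adp basic have "leaf_mass (relabel f T) = 1"
      unfolding adp_bAST_def by fastforce
    then show "leaf_mass T = 1" by simp
  qed
qed

end
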